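(* For every $k\ge 1$ there is a bijection $\Phi$ between semistandard oscillating tableaux of length $k$ and $k\times k$ natural-number fixed-point-free involutions, such that if $\Phi(\mu^0,\ldots,\mu^k)=A$ then for each $1\le i\le k$, $r_i(A)=\max(|\mu^i|-|\mu^{i-1}|,0)$ and $c_i(A)=\max(|\mu^{i-1}|-|\mu^i|,0)$; that is, the row content records the increases and the column content records the decreases of the oscillating tableau.
   Context: A vertical strip is a skew diagram with at most one box in each row. A semistandard oscillating tableau of length $k$ is a sequence of partitions $(\mu^0=\emptyset,\mu^1,\ldots,\mu^k=\emptyset)$ such that for all $i$, $\mu^i$ and $\mu^{i+1}$ differ by a vertical strip (one contains the other and their difference is a vertical strip). $|\mu|$ denotes the number of boxes. For a $k\times k$ symmetric matrix $A=(a_{ij})$ with entries in $\mathbb{Z}_{\ge0}$, let $r_i=\sum_{j\ge i}a_{ij}$ (the $i$-th row from the main diagonal to the right end) and $c_i=\sum_{j\le i}a_{ji}$ (the $i$-th column from the top down to the main diagonal). $A$ is a natural-number fixed-point-free involution if it is symmetric with natural-number entries and $r_i=0$ or $c_i=0$ for every $i$. *)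

theory Defs
  imports "Jordan_Normal_Form.Matrix"
begin

definition is_partition :: "nat list \<Rightarrow> bool" where
  "is_partition \<mu> \<longleftrightarrow> sorted_wrt (\<ge>) \<mu> \<and> 0 \<notin> set \<mu>"

definition young_diagram :: "nat list \<Rightarrow> (nat \<times> nat) set" where
  "young_diagram \<mu> = {(r, c). r < length \<mu> \<and> c < \<mu> ! r}"

abbreviation num_boxes :: "nat list \<Rightarrow> nat" where
  "num_boxes \<mu> \<equiv> card (young_diagram \<mu>)"

text \<open>The skew diagram of shape \<open>\<nu> / \<mu>\<close> exists and is a vertical strip; the strip may be empty.\<close>

definition vertical_strip :: "nat list \<Rightarrow> nat list \<Rightarrow> bool" where
  "vertical_strip \<nu> \<mu> \<longleftrightarrow> young_diagram \<mu> \<subseteq> young_diagram \<nu> \<and>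
     (\<forall>r. card {c. (r, c) \<in> young_diagram \<nu> - young_diagram \<mu>} \<le> 1)"

text \<open>A tableau of length \<open>k\<close> has \<open>k + 1\<close> entries, \<open>T ! i\<close> being the partition \<open>\<mu>\<^sup>i\<close>.\<close>

definition oscillating_tableau :: "nat \<Rightarrow> nat list list \<Rightarrow> bool" where
  "oscillating_tableau k T \<longleftrightarrow> length T = k + 1 \<and> (\<forall>\<mu> \<in> set T. is_partition \<mu>) \<and>
     T ! 0 = [] \<and> T ! k = [] \<and>
     (\<forall>i<k. vertical_strip (T ! Suc i) (T ! i) \<or> vertical_strip (T ! i) (T ! Suc i))"

text \<open>Matrix indices start at 0, so \<open>row_content A i\<close> and \<open>col_content A i\<close> are
  \<open>r\<close> and \<open>c\<close> of the customary 1-based index \<open>i + 1\<close>. The diagonal entry counts in both.\<close>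

definition row_content :: "nat mat \<Rightarrow> nat \<Rightarrow> nat" where
  "row_content A i = (\<Sum>j = i..<dim_col A. A $$ (i, j))"

definition col_content :: "nat mat \<Rightarrow> nat \<Rightarrow> nat" where
  "col_content A i = (\<Sum>j\<le>i. A $$ (j, i))"

definition nat_fpf_involution :: "nat \<Rightarrow> nat mat \<Rightarrow> bool" where
  "nat_fpf_involution k A \<longleftrightarrow> A \<in> carrier_mat k k \<and> transpose_mat A = A \<and>
     (\<forall>i<k. row_content A i = 0 \<or> col_content A i = 0)"

end

theory Submission
  imports Defs
begin

text \<open>Both sides are counted for a fixed sequence of sizes \<open>s i = |\<mu>\<^sup>i|\<close>, which determines all row and
  column contents; equality of the finite counts for each \<open>s\<close> yields the bijection. After conjugation,
  vertical strips become horizontal strips, that is, interlacing of partitions.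

  Write \<open>U\<^sub>a\<close> for adding and \<open>D\<^sub>b\<close> for removing a horizontal strip of size \<open>a\<close> or \<open>b\<close>. The local rule
  of Robinson-Schensted-Knuth says that going up by \<open>U\<^sub>a\<close> and then down by \<open>D\<^sub>b\<close> can be done in as many
  ways as going down by \<open>D\<^bsub>b-j\<^esub>\<close> and then up by \<open>U\<^bsub>a-j\<^esub>\<close> for some \<open>j \<ge> 0\<close>. Hence removing a strip of
  size \<open>b\<close> from the end of a chain of strips of sizes \<open>v 0, v 1, \<dots>\<close> that starts at the empty partition
  amounts to choosing \<open>x \<le> v\<close> of sum \<open>b\<close> and replacing \<open>v\<close> by \<open>v - x\<close>. The vectors \<open>x\<close> chosen in the
  successive down steps are the columns of the strictly upper triangular part of the matrix.\<close>

section \<open>Partitions and horizontal strips\<close>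

text \<open>A partition of \<open>n\<close>, padded with zeros; since it has at most \<open>n\<close> parts, \<open>f n = 0\<close> loses nothing.\<close>

definition parts_of :: "nat \<Rightarrow> (nat \<Rightarrow> nat) set" where
  "parts_of n = {f. antimono f \<and> f n = 0 \<and> (\<Sum>i<n. f i) = n}"

text \<open>That is, \<open>g / f\<close> is a horizontal strip.\<close>

definition interlaces :: "(nat \<Rightarrow> nat) \<Rightarrow> (nat \<Rightarrow> nat) \<Rightarrow> bool" where
  "interlaces f g \<longleftrightarrow> (\<forall>i. f i \<le> g i \<and> g (Suc i) \<le> f i)"

lemma interlaces_antimono:
  assumes "interlaces f g"
  shows "antimono f" "antimono g"
proof -
  have "f (Suc i) \<le> f i" "g (Suc i) \<le> g i" for i
    using assms order_trans[of "f (Suc i)" "g (Suc i)" "f i"] order_trans[of "g (Suc i)" "f i" "g i"]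
    by (auto simp: interlaces_def)
  then show "antimono f" "antimono g" by (simp_all add: antimono_iff_le_Suc)
qed

lemma sum_beyond_zero:
  fixes f :: "nat \<Rightarrow> nat"
  assumes "antimono f" "f n = 0" "n \<le> N"
  shows "f N = 0" "(\<Sum>i<N. f i) = (\<Sum>i<n. f i)"
proof -
  have z: "f i = 0" if "n \<le> i" for i
    using antimonoD[OF assms(1) that] assms(2) by simp
  then show "f N = 0" using assms(3) by simp
  show "(\<Sum>i<N. f i) = (\<Sum>i<n. f i)"
    using assms(3) z by (intro sum.mono_neutral_right) auto
qed

lemma parts_ofD:
  assumes "f \<in> parts_of n"
  shows "antimono f" and "n \<le> N \<Longrightarrow> f N = 0" and "n \<le> N \<Longrightarrow> (\<Sum>i<N. f i) = n"
  using assms sum_beyond_zero[of f n N] by (auto simp: parts_of_def)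

text \<open>Any cut-off \<open>N\<close> beyond the support may replace \<open>n\<close>: if
  \<open>f n\<close> were positive, the first \<open>n + 1\<close> entries would all be at least 1
  and their sum would exceed \<open>n\<close>.\<close>

lemma parts_ofI:
  assumes f: "antimono f" "f N = 0" and n: "(\<Sum>i<N. f i) = n"
  shows "f \<in> parts_of n"
proof -
  have "f n = 0"
  proof (rule ccontr)
    assume pos: "f n \<noteq> 0"
    then have less: "n < N"
      using antimonoD[OF f(1), of N n] f(2) by (cases "n < N") (auto simp: not_less)
    have "(\<Sum>i<Suc n. 1) \<le> (\<Sum>i<Suc n. f i)"
      using pos antimonoD[OF f(1), of _ n] by (intro sum_mono) (force simp: less_Suc_eq_le)
    also have "\<dots> \<le> (\<Sum>i<N. f i)"
      using less by (intro sum_mono2) auto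
    finally show False using n by simp
  qed
  moreover have "(\<Sum>i<n. f i) = n"
  proof (cases "n \<le> N")
    case True
    then show ?thesis using sum_beyond_zero(2)[OF f(1) \<open>f n = 0\<close> True] n by simp
  next
    case False
    then show ?thesis using sum_beyond_zero(2)[OF f, of n] n by simp
  qed
  ultimately show ?thesis using f(1) by (simp add: parts_of_def)
qed

lemma parts_of_unique:
  assumes "f \<in> parts_of m" "f \<in> parts_of n"
  shows "m = n"
  using parts_ofD(3)[OF assms(1), of "m + n"] parts_ofD(3)[OF assms(2), of "m + n"] by linarith

lemma finite_parts_of: "finite (parts_of n)"
proof -
  have "parts_of n \<subseteq> {f. \<forall>i. (i \<in> {..<n} \<longrightarrow> f i \<in> {..n}) \<and> (i \<notin> {..<n} \<longrightarrow> f i = 0)}"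
  proof clarify
    fix f i assume f: "f \<in> parts_of n"
    have "f i \<le> (\<Sum>i<n. f i)" if "i < n" using that by (intro member_le_sum) auto
    then show "(i \<in> {..<n} \<longrightarrow> f i \<in> {..n}) \<and> (i \<notin> {..<n} \<longrightarrow> f i = 0)"
      using parts_ofD(3)[OF f, of n] parts_ofD(2)[OF f, of i] by auto
  qed
  moreover have "finite {f. \<forall>i. (i \<in> {..<n} \<longrightarrow> f i \<in> {..n}) \<and> (i \<notin> {..<n} \<longrightarrow> f i = (0::nat))}"
    by (rule finite_set_of_finite_funs) auto
  ultimately show ?thesis by (rule finite_subset)
qed

lemma parts_of_0: "parts_of 0 = {\<lambda>_. 0}"
proof -
  have "f = (\<lambda>_. 0)" if "f \<in> parts_of 0" for f
    using parts_ofD(2)[OF that] by (intro ext) simp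
  moreover have "(\<lambda>_. 0) \<in> parts_of 0" by (simp add: parts_of_def antimono_iff_le_Suc)
  ultimately show ?thesis by blast
qed

lemma interlaces_size_le:
  assumes "interlaces f g" "f \<in> parts_of m" "g \<in> parts_of n"
  shows "m \<le> n"
proof -
  have "(\<Sum>i<m+n. f i) \<le> (\<Sum>i<m+n. g i)"
    using assms(1) by (intro sum_mono) (auto simp: interlaces_def)
  then show ?thesis using assms parts_ofD(3) by simp
qed

lemma interlaces_same_size:
  assumes "f \<in> parts_of n" "g \<in> parts_of n"
  shows "interlaces f g \<longleftrightarrow> f = g"
proof
  assume *: "interlaces f g"
  show "f = g"
  proof
    fix i
    \<comment> \<open>The range is long enough to contain all of both partitions and also the index
      \<open>i\<close>.\<close>
    have "(\<Sum>j<n+Suc i. f j) = (\<Sum>j<n+Suc i. g j)" 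
      using parts_ofD(3)[OF assms(1)] parts_ofD(3)[OF assms(2)] by (simp del: sum.lessThan_Suc add_Suc_right)
    moreover have "\<forall>j\<in>{..<n+Suc i}. f j \<le> g j" using * by (auto simp: interlaces_def)
    ultimately show "f i = g i"
      using sum_mono_inv[of f "{..<n+Suc i}" g i] by auto
  qed
next
  assume "f = g"
  then show "interlaces f g"
    using parts_ofD(1)[OF assms(1)] by (auto simp: interlaces_def antimono_iff_le_Suc)
qed

text \<open>The sizes decide the direction of a step; for equal sizes both directions collapse to
  equality.\<close>

lemma interlaces_iff_comparable:
  assumes "f \<in> parts_of m" "g \<in> parts_of n" "m \<le> n"
  shows "interlaces f g \<or> interlaces g f \<longleftrightarrow> interlaces f g"
proof -
  have "m = n" if "interlaces g f" using interlaces_size_le[OF that assms(2,1)] assms(3) by simp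
  then show ?thesis using interlaces_same_size[of f m g] interlaces_same_size[of g m f] assms by blast
qed

section \<open>The local rule\<close>

text \<open>If \<open>\<mu>\<close> is above \<open>f\<close> and \<open>g\<close>, then \<open>\<mu> (Suc i)\<close> ranges over the interval between
  \<open>max (f (Suc i)) (g (Suc i))\<close> and \<open>min (f i) (g i)\<close>; if \<open>\<kappa>\<close> is below both, then so does
  \<open>\<kappa> i\<close>. The local rule reflects the interval, \<open>reflected f g i\<close> being the sum of its ends.\<close>

definition reflected :: "(nat \<Rightarrow> nat) \<Rightarrow> (nat \<Rightarrow> nat) \<Rightarrow> nat \<Rightarrow> nat" where
  "reflected f g i = max (f (Suc i)) (g (Suc i)) + min (f i) (g i)"

text \<open>The maxima in \<open>reflected\<close> are shifted by one index, and
  \<open>max (f 0) (g 0)\<close> is the missing one. Then use that a maximum and a minimum add up to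
  \<open>f i + g i\<close>.\<close>

lemma sum_reflected:
  assumes f: "f \<in> parts_of l" and g: "g \<in> parts_of n" and N: "l \<le> N" "n \<le> N"
  shows "(\<Sum>i<N. reflected f g i) + max (f 0) (g 0) = l + n"
proof -
  have "(\<Sum>i<N. max (f (Suc i)) (g (Suc i))) + max (f 0) (g 0) = (\<Sum>i<Suc N. max (f i) (g i))"
    by (subst sum.lessThan_Suc_shift) simp
  also have "\<dots> = (\<Sum>i<N. max (f i) (g i))"
    using parts_ofD(2)[OF f N(1)] parts_ofD(2)[OF g N(2)] by simp
  finally have "(\<Sum>i<N. reflected f g i) + max (f 0) (g 0) = (\<Sum>i<N. max (f i) (g i) + min (f i) (g i))"
    by (simp add: reflected_def sum.distrib)
  also have "\<dots> = (\<Sum>i<N. f i + g i)" by (intro sum.cong) auto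
  finally show ?thesis
    using parts_ofD(3)[OF f N(1)] parts_ofD(3)[OF g N(2)] by (simp add: sum.distrib)
qed

text \<open>The entries of \<open>\<kappa>\<close> and the shifted entries of \<open>\<mu>\<close>
  have a known total, so the size of one partition determines that of the other.\<close>

lemma reflect_size:
  assumes f: "f \<in> parts_of l" and g: "g \<in> parts_of n"
    and refl: "\<And>i. \<kappa> i + \<mu> (Suc i) = reflected f g i"
    and anti: "antimono \<kappa>" "antimono \<mu>"
    and size: "\<mu> 0 + l + n = m + p + max (f 0) (g 0)"
  shows "\<mu> \<in> parts_of m \<longleftrightarrow> \<kappa> \<in> parts_of p"
proof -
  define N where "N = l + n + m + p"
  have "reflected f g N = 0"
    using parts_ofD(2)[OF f] parts_ofD(2)[OF g] by (simp add: N_def reflected_def)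
  then have z: "\<kappa> N = 0" "\<mu> (Suc N) = 0" using refl[of N] by auto
  have "(\<Sum>i<Suc N. \<mu> i) = \<mu> 0 + (\<Sum>i<N. \<mu> (Suc i))" by (rule sum.lessThan_Suc_shift)
  moreover have "(\<Sum>i<N. \<kappa> i) + (\<Sum>i<N. \<mu> (Suc i)) = (\<Sum>i<N. reflected f g i)"
    by (simp add: refl flip: sum.distrib)
  ultimately have "(\<Sum>i<Suc N. \<mu> i) + (\<Sum>i<N. \<kappa> i) = m + p"
    using sum_reflected[OF f g, of N] size by (simp add: N_def)
  moreover have "\<mu> \<in> parts_of m \<longleftrightarrow> (\<Sum>i<Suc N. \<mu> i) = m"
    using parts_ofI[OF anti(2) z(2)] parts_ofD(3)[of \<mu> m "Suc N"] by (auto simp: N_def)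
  moreover have "\<kappa> \<in> parts_of p \<longleftrightarrow> (\<Sum>i<N. \<kappa> i) = p"
    using parts_ofI[OF anti(1) z(1)] parts_ofD(3)[of \<kappa> p N] by (auto simp: N_def)
  ultimately show ?thesis by auto
qed

text \<open>Reflection preserves each interval and leaves out only \<open>\<mu> 0\<close>, which is
  encoded in the size \<open>p\<close> of the image by
  \<open>\<mu> 0 + l + n = m + p + max (f 0) (g 0)\<close>. The bound
  \<open>l + n - m \<le> p\<close> is thus the condition
  \<open>max (f 0) (g 0) \<le> \<mu> 0\<close>, while \<open>p \<le> n\<close> holds because
  \<open>\<kappa>\<close> lies below \<open>g\<close>.\<close>

lemma bij_betw_local_rule:
  assumes f: "f \<in> parts_of l" and g: "g \<in> parts_of n"
  shows "bij_betw (\<lambda>\<mu> i. reflected f g i - \<mu> (Suc i))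
    {\<mu> \<in> parts_of m. interlaces f \<mu> \<and> interlaces g \<mu>}
    (\<Union>p\<in>{l + n - m..n}. {\<kappa> \<in> parts_of p. interlaces \<kappa> f \<and> interlaces \<kappa> g})"
    (is "bij_betw ?\<phi> ?A ?B")
proof -
  \<comment> \<open>Entry 0 solves the size equation for \<open>\<mu> 0\<close>; the first
    \<open>l + n\<close> entries of \<open>\<kappa>\<close> give its full size because
    \<open>p \<le> n\<close>.\<close>
  let ?\<psi> = "\<lambda>\<kappa> i. case i of 0 \<Rightarrow> m + (\<Sum>i<l+n. \<kappa> i) + max (f 0) (g 0) - (l + n)
                        | Suc i \<Rightarrow> reflected f g i - \<kappa> i"
  have fwd: "?\<phi> \<mu> \<in> ?B \<and> ?\<psi> (?\<phi> \<mu>) = \<mu>" if "\<mu> \<in> ?A" for \<mu>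
  proof -
    from that have mu: "\<mu> \<in> parts_of m" "interlaces f \<mu>" "interlaces g \<mu>" by auto
    have b: "max (f (Suc i)) (g (Suc i)) \<le> \<mu> (Suc i)" "\<mu> (Suc i) \<le> min (f i) (g i)"
       "max (f 0) (g 0) \<le> \<mu> 0" for i
      using mu(2,3) by (auto simp: interlaces_def)
    have le: "\<mu> (Suc i) \<le> reflected f g i" for i
      using b(2)[of i] unfolding reflected_def by linarith
    have "?\<phi> \<mu> i \<le> min (f i) (g i)" "max (f (Suc i)) (g (Suc i)) \<le> ?\<phi> \<mu> i" for i
      using b(1,2)[of i] unfolding reflected_def by linarith+
    then have k1: "interlaces (?\<phi> \<mu>) f" "interlaces (?\<phi> \<mu>) g"
      by (auto simp: interlaces_def)
    have anti: "antimono (?\<phi> \<mu>)" "antimono \<mu>"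
      by (fact interlaces_antimono(1)[OF k1(1)] interlaces_antimono(2)[OF mu(2)])+
    have sz: "(\<Sum>i<l+n+m. ?\<phi> \<mu> i) + m + max (f 0) (g 0) = l + n + \<mu> 0"
    proof -
      have "(\<Sum>i<l+n+m. ?\<phi> \<mu> i) + (\<Sum>i<l+n+m. \<mu> (Suc i)) = (\<Sum>i<l+n+m. reflected f g i)"
        using le by (simp flip: sum.distrib)
      moreover have "m = \<mu> 0 + (\<Sum>i<l+n+m. \<mu> (Suc i))"
        using parts_ofD(3)[OF mu(1), of "Suc (l+n+m)"] by (simp add: sum.lessThan_Suc_shift del: sum.lessThan_Suc)
      ultimately show ?thesis using sum_reflected[OF f g, of "l+n+m"] by linarith
    qed
    define p where "p = (\<Sum>i<l+n+m. ?\<phi> \<mu> i)"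
    have k: "?\<phi> \<mu> \<in> parts_of p"
    proof (rule reflect_size[THEN iffD1, OF f g _ anti(1,2) _ mu(1)])
      show "?\<phi> \<mu> i + \<mu> (Suc i) = reflected f g i" for i using le[of i] by simp
      show "\<mu> 0 + l + n = m + p + max (f 0) (g 0)" using sz unfolding p_def by linarith
    qed
    have pn: "p \<le> n" "p \<le> l" by (fact interlaces_size_le[OF k1(2) k g] interlaces_size_le[OF k1(1) k f])+
    have "?\<phi> \<mu> \<in> ?B"
    proof (rule UN_I[of p])
      have "l + n - m \<le> p" using b(3) sz unfolding p_def[symmetric] by linarith
      then show "p \<in> {l + n - m..n}" using pn by simp
    qed (use k1 k in simp)
    moreover have "?\<psi> (?\<phi> \<mu>) = \<mu>"
    proof
      fix i show "?\<psi> (?\<phi> \<mu>) i = \<mu> i"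
        using le sz parts_ofD(3)[OF k, of "l+n"] pn by (cases i) (auto simp: p_def[symmetric])
    qed
    ultimately show ?thesis by (rule conjI)
  qed
  have bwd: "?\<psi> \<kappa> \<in> ?A \<and> ?\<phi> (?\<psi> \<kappa>) = \<kappa>" if "\<kappa> \<in> ?B" for \<kappa>
  proof -
    from that obtain p where k: "\<kappa> \<in> parts_of p" "interlaces \<kappa> f" "interlaces \<kappa> g"
      and p: "l + n - m \<le> p" "p \<le> n" by auto
    have sp: "(\<Sum>i<l+n. \<kappa> i) = p" using parts_ofD(3)[OF k(1), of "l+n"] p by simp
    have b: "max (f (Suc i)) (g (Suc i)) \<le> \<kappa> i" "\<kappa> i \<le> min (f i) (g i)" for i
      using k by (auto simp: interlaces_def)
    have le: "\<kappa> i \<le> reflected f g i" for i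
      using b(2)[of i] unfolding reflected_def by linarith
    have r: "?\<phi> (?\<psi> \<kappa>) = \<kappa>" using le by (intro ext) simp
    have "?\<psi> \<kappa> 0 = m + p + max (f 0) (g 0) - (l + n)" using sp by simp
    then have m0: "?\<psi> \<kappa> 0 + l + n = m + p + max (f 0) (g 0)" "max (f 0) (g 0) \<le> ?\<psi> \<kappa> 0"
      using p by linarith+
    have i1: "interlaces f (?\<psi> \<kappa>)" "interlaces g (?\<psi> \<kappa>)"
      unfolding interlaces_def
    proof (safe)
      fix i
      show "f i \<le> ?\<psi> \<kappa> i" "g i \<le> ?\<psi> \<kappa> i"
      proof (atomize (full), cases i)
        case 0
        then show "f i \<le> ?\<psi> \<kappa> i \<and> g i \<le> ?\<psi> \<kappa> i" using m0(2) by simp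
      next
        case (Suc j)
        have "max (f (Suc j)) (g (Suc j)) \<le> reflected f g j - \<kappa> j"
          using b(2)[of j] unfolding reflected_def by linarith
        then show "f i \<le> ?\<psi> \<kappa> i \<and> g i \<le> ?\<psi> \<kappa> i" using Suc by simp
      qed
      have "reflected f g i - \<kappa> i \<le> min (f i) (g i)"
        using b(1)[of i] unfolding reflected_def by linarith
      then show "?\<psi> \<kappa> (Suc i) \<le> f i" "?\<psi> \<kappa> (Suc i) \<le> g i" by simp_all
    qed
    have anti: "antimono \<kappa>" "antimono (?\<psi> \<kappa>)"
      by (fact interlaces_antimono(1)[OF k(2)] interlaces_antimono(2)[OF i1(1)])+
    have "?\<psi> \<kappa> \<in> parts_of m"
    proof (rule reflect_size[THEN iffD2, OF f g _ anti m0(1) k(1)])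
      show "\<kappa> i + ?\<psi> \<kappa> (Suc i) = reflected f g i" for i using le[of i] by simp
    qed
    then show ?thesis using i1 r by simp
  qed
  show ?thesis
  proof (rule bij_betw_byWitness[where f' = ?\<psi>])
    show "\<forall>\<mu>\<in>?A. ?\<psi> (?\<phi> \<mu>) = \<mu>" using fwd by (intro ballI) (rule conjunct2)
    show "\<forall>\<kappa>\<in>?B. ?\<phi> (?\<psi> \<kappa>) = \<kappa>" using bwd by (intro ballI) (rule conjunct2)
    show "?\<phi> ` ?A \<subseteq> ?B" using fwd by (intro image_subsetI) (rule conjunct1)
    show "?\<psi> ` ?B \<subseteq> ?A" using bwd by (intro image_subsetI) (rule conjunct1)
  qed
qed

lemma card_local_rule:
  assumes f: "f \<in> parts_of l" and g: "g \<in> parts_of n"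
  shows "card {\<mu> \<in> parts_of m. interlaces f \<mu> \<and> interlaces g \<mu>} =
    (\<Sum>p\<in>{l + n - m..n}. card {\<kappa> \<in> parts_of p. interlaces \<kappa> f \<and> interlaces \<kappa> g})"
  unfolding bij_betw_same_card[OF bij_betw_local_rule[OF assms]]
  by (rule card_UN_disjoint) (use finite_parts_of parts_of_unique in auto)

section \<open>Chains of horizontal strips\<close>

text \<open>The number of chains from the empty partition to \<open>f\<close> that add horizontal strips of sizes
  \<open>v 0, \<dots>, v (m - 1)\<close>. The size of the last strip is implicit: \<open>f\<close> has to have size
  \<open>\<Sum>j<m. v j\<close> for this reading.\<close>

fun chain_count :: "nat \<Rightarrow> (nat \<Rightarrow> nat) \<Rightarrow> (nat \<Rightarrow> nat) \<Rightarrow> nat" where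
  "chain_count 0 v f = of_bool (f = (\<lambda>_. 0))"
| "chain_count (Suc m) v f =
    (\<Sum>g\<in>{g \<in> parts_of (\<Sum>j<m. v j). interlaces g f}. chain_count m v g)"

lemma chain_count_cong:
  "(\<And>j. j < m \<Longrightarrow> v j = w j) \<Longrightarrow> chain_count m v f = chain_count m w f"
proof (induction m arbitrary: f)
  case (Suc m)
  have "(\<Sum>j<m. v j) = (\<Sum>j<m. w j)" using Suc.prems by (intro sum.cong) auto
  then show ?case using Suc by simp
qed simp

lemma chain_count_zero:
  assumes "\<And>j. v j = 0"
  shows "chain_count m v (\<lambda>_. 0) = 1"
proof (induction m)
  case (Suc m)
  have "{g \<in> parts_of 0. interlaces g (\<lambda>_. 0)} = {\<lambda>_. 0}"
    by (auto simp: parts_of_0 interlaces_def)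
  then show ?case using Suc assms by simp
qed simp

text \<open>These are the remainders \<open>v - x\<close> after a removal, not the removed vectors
  \<open>x\<close>; \<open>n\<close> is the size that is left. Zeros from \<open>m\<close> on make
  each vector a unique function.\<close>

definition subvectors :: "nat \<Rightarrow> (nat \<Rightarrow> nat) \<Rightarrow> nat \<Rightarrow> (nat \<Rightarrow> nat) set" where
  "subvectors m v n = {y. (\<forall>j<m. y j \<le> v j) \<and> (\<forall>j\<ge>m. y j = 0) \<and> (\<Sum>j<m. y j) = n}"

lemma finite_subvectors: "finite (subvectors m v n)"
proof -
  have "finite {f. \<forall>j. (j \<in> {..<m} \<longrightarrow> f j \<in> {..n}) \<and> (j \<notin> {..<m} \<longrightarrow> f j = (0::nat))}"
    by (rule finite_set_of_finite_funs) auto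
  moreover have "y j \<le> (\<Sum>j<m. y j)" if "j < m" for y :: "nat \<Rightarrow> nat" and j
    using that by (intro member_le_sum) auto
  then have "subvectors m v n \<subseteq>
      {f. \<forall>j. (j \<in> {..<m} \<longrightarrow> f j \<in> {..n}) \<and> (j \<notin> {..<m} \<longrightarrow> f j = (0::nat))}"
    by (auto simp: subvectors_def)
  ultimately show ?thesis by (rule finite_subset[rotated])
qed

text \<open>Splits off the last coordinate \<open>n - p\<close>. The bound
  \<open>y m \<le> v m\<close> becomes the range of \<open>p\<close> that the local rule
  produces.\<close>

lemma sum_subvectors_Suc:
  "(\<Sum>y\<in>subvectors (Suc m) v n. F y) =
    (\<Sum>p\<in>{n - v m..n}. \<Sum>y\<in>subvectors m v p. F (y(m := n - p)))"
proof -
  have "(\<Sum>p\<in>{n - v m..n}. \<Sum>y\<in>subvectors m v p. F (y(m := n - p))) =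
      (\<Sum>(p, y)\<in>(SIGMA p:{n - v m..n}. subvectors m v p). F (y(m := n - p)))"
    by (rule sum.Sigma) (auto simp: finite_subvectors)
  also have "\<dots> = (\<Sum>y\<in>subvectors (Suc m) v n. F y)"
    by (rule sum.reindex_bij_witness[where j = "\<lambda>(p, y). y(m := n - p)"
          and i = "\<lambda>y. (n - y m, y(m := 0))"])
      (auto simp: subvectors_def less_Suc_eq fun_eq_iff Suc_le_eq)
  finally show ?thesis by simp
qed

lemma subvectors_full:
  assumes "\<And>j. j \<ge> m \<Longrightarrow> v j = 0"
  shows "subvectors m v (\<Sum>j<m. v j) = {v}"
proof -
  have "y = v" if "y \<in> subvectors m v (\<Sum>j<m. v j)" for y
  proof
    fix j show "y j = v j"
      using that assms sum_mono_inv[of y "{..<m}" v j] by (cases "j < m") (auto simp: subvectors_def)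
  qed
  then show ?thesis using assms by (auto simp: subvectors_def)
qed

text \<open>Induction on the number of strips: the local rule moves the removal past the last
  addition, and the induction hypothesis then moves it through the shorter chain.\<close>

lemma chain_count_remove_strip:
  assumes "f \<in> parts_of n"
  shows "(\<Sum>g\<in>{g \<in> parts_of (\<Sum>j<m. v j). interlaces f g}. chain_count m v g) =
    (\<Sum>y\<in>subvectors m v n. chain_count m y f)"
  using assms
proof (induction m arbitrary: f n)
  \<comment> \<open>The empty chain ends at the empty partition, from which only the empty strip can
    be removed.\<close>
  case 0
  have "interlaces f (\<lambda>_. 0) \<longleftrightarrow> f = (\<lambda>_. 0)"
    by (auto simp: interlaces_def fun_eq_iff)
  then have "{g \<in> parts_of 0. interlaces f g} = (if f = (\<lambda>_. 0) then {\<lambda>_. 0} else {})"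
    by (auto simp: parts_of_0)
  moreover have "subvectors 0 v n = (if n = 0 then {\<lambda>_. 0} else {})"
    by (auto simp: subvectors_def)
  moreover have "n = 0 \<longleftrightarrow> f = (\<lambda>_. 0)"
    using 0 parts_of_unique[of f n 0] by (auto simp: parts_of_0)
  ultimately show ?case by simp
next
  case (Suc m)
  let ?s = "\<Sum>j<m. v j"
  note [simp] = finite_parts_of finite_subvectors
  have "(\<Sum>g\<in>{g \<in> parts_of (?s + v m). interlaces f g}. chain_count (Suc m) v g) =
      (\<Sum>h\<in>parts_of ?s. \<Sum>g | g \<in> {g \<in> parts_of (?s + v m). interlaces f g} \<and> interlaces h g. chain_count m v h)"
    unfolding chain_count.simps by (rule sum.swap_restrict) auto
  also have "\<dots> = (\<Sum>h\<in>parts_of ?s. \<Sum>p\<in>{n - v m..n}.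
      \<Sum>k | k \<in> {k \<in> parts_of p. interlaces k f} \<and> interlaces k h. chain_count m v h)"
  proof (rule sum.cong[OF refl])
    fix h assume "h \<in> parts_of ?s"
    \<comment> \<open>The partition \<open>g\<close> above \<open>h\<close> and \<open>f\<close> is
      traded for some \<open>k\<close> below both; with \<open>l = ?s\<close> the lower end of the
      range simplifies to \<open>n - v m\<close>.\<close>
    from card_local_rule[OF this Suc.prems, of "?s + v m"]
    show "(\<Sum>g | g \<in> {g \<in> parts_of (?s + v m). interlaces f g} \<and> interlaces h g. chain_count m v h) =
      (\<Sum>p\<in>{n - v m..n}. \<Sum>k | k \<in> {k \<in> parts_of p. interlaces k f} \<and> interlaces k h. chain_count m v h)"
      by (simp add: conj_ac sum_distrib_right)
  qed
  also have "\<dots> = (\<Sum>p\<in>{n - v m..n}. \<Sum>h\<in>parts_of ?s.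
      \<Sum>k | k \<in> {k \<in> parts_of p. interlaces k f} \<and> interlaces k h. chain_count m v h)"
    by (rule sum.swap)
  also have "\<dots> = (\<Sum>p\<in>{n - v m..n}. \<Sum>k\<in>{k \<in> parts_of p. interlaces k f}.
      \<Sum>h\<in>{h \<in> parts_of ?s. interlaces k h}. chain_count m v h)"
    by (rule sum.cong[OF refl], rule sum.swap_restrict[symmetric]) auto
  also have "\<dots> = (\<Sum>p\<in>{n - v m..n}. \<Sum>k\<in>{k \<in> parts_of p. interlaces k f}.
      \<Sum>y\<in>subvectors m v p. chain_count m y k)"
    by (intro sum.cong refl Suc.IH) auto
  also have "\<dots> = (\<Sum>p\<in>{n - v m..n}. \<Sum>y\<in>subvectors m v p.
      \<Sum>k\<in>{k \<in> parts_of p. interlaces k f}. chain_count m y k)"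
    by (intro sum.cong refl sum.swap)
  also have "\<dots> = (\<Sum>p\<in>{n - v m..n}. \<Sum>y\<in>subvectors m v p. chain_count (Suc m) (y(m := n - p)) f)"
  proof (intro sum.cong refl)
    fix p y assume "y \<in> subvectors m v p"
    then have "(\<Sum>j<m. (y(m := n - p)) j) = p" by (simp add: subvectors_def)
    moreover have "chain_count m (y(m := n - p)) k = chain_count m y k" for k
      by (rule chain_count_cong) simp
    ultimately show "(\<Sum>k\<in>{k \<in> parts_of p. interlaces k f}. chain_count m y k) =
        chain_count (Suc m) (y(m := n - p)) f" by simp
  qed
  also have "\<dots> = (\<Sum>y\<in>subvectors (Suc m) v n. chain_count (Suc m) y f)"
    by (rule sum_subvectors_Suc[symmetric])
  finally show ?case by simp
qed

text \<open>Covers both directions at once by truncated subtraction. Going up, the only remainder is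
  \<open>v\<close> itself and a new strip is appended; going down, the appended strip is empty and
  the previous lemma applies.\<close>

lemma chain_count_step:
  assumes v: "\<And>j. j \<ge> m \<Longrightarrow> v j = 0" and g: "g \<in> parts_of n"
  shows "(\<Sum>f\<in>{f \<in> parts_of (\<Sum>j<m. v j). interlaces f g \<or> interlaces g f}. chain_count m v f) =
    (\<Sum>y\<in>subvectors m v (min (\<Sum>j<m. v j) n). chain_count (Suc m) (y(m := n - (\<Sum>j<m. v j))) g)"
proof -
  let ?s = "\<Sum>j<m. v j"
  have upd: "(\<Sum>j<m. (y(m := c)) j) = (\<Sum>j<m. y j)" "chain_count m (y(m := c)) f = chain_count m y f"
    for y f and c :: nat
    by (simp, rule chain_count_cong) simp
  show ?thesis
  proof (cases "?s \<le> n")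
    case True
    then have "{f \<in> parts_of ?s. interlaces f g \<or> interlaces g f} = {f \<in> parts_of ?s. interlaces f g}"
      using interlaces_iff_comparable[OF _ g] by blast
    then show ?thesis using True by (simp add: subvectors_full[OF v] upd del: fun_upd_apply)
  next
    case False
    then have "{f \<in> parts_of ?s. interlaces f g \<or> interlaces g f} = {f \<in> parts_of ?s. interlaces g f}"
      using interlaces_iff_comparable[OF g, of _ ?s] by auto
    moreover have "{f \<in> parts_of n. interlaces f g} = {g}"
      using interlaces_same_size g by blast
    then have "chain_count (Suc m) (y(m := n - ?s)) g = chain_count m y g" if "y \<in> subvectors m v n" for y
      using that by (simp add: upd subvectors_def del: fun_upd_apply)
    ultimately show ?thesis using False chain_count_remove_strip[OF g, of m v] by (simp add: min_def)
  qed
qed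

section \<open>Walks and fillings\<close>

text \<open>The part of a tableau from time \<open>m\<close> on, in conjugated form. Zeros at all
  other times make each walk a unique function; closing at the empty partition is imposed through
  \<open>s k = 0\<close>.\<close>

definition walks :: "nat \<Rightarrow> (nat \<Rightarrow> nat) \<Rightarrow> nat \<Rightarrow> (nat \<Rightarrow> nat) \<Rightarrow> (nat \<Rightarrow> nat \<Rightarrow> nat) set" where
  "walks k s m f = {T. T m = f \<and> (\<forall>i. i < m \<or> k < i \<longrightarrow> T i = (\<lambda>_. 0)) \<and>
     (\<forall>i\<in>{m<..k}. T i \<in> parts_of (s i)) \<and>
     (\<forall>i\<in>{m..<k}. interlaces (T i) (T (Suc i)) \<or> interlaces (T (Suc i)) (T i))}"

definition steps :: "nat \<Rightarrow> (nat \<Rightarrow> nat) \<Rightarrow> (nat \<Rightarrow> nat) set" where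
  "steps n f = {g \<in> parts_of n. interlaces f g \<or> interlaces g f}"

lemma finite_steps: "finite (steps n f)"
  by (simp add: steps_def finite_parts_of)

lemma walks_end: "walks k s k f = {(\<lambda>_ _. 0)(k := f)}"
  by (auto simp: walks_def fun_eq_iff not_less_iff_gr_or_eq) (metis linorder_neqE_nat)

lemma bij_betw_walks_Suc:
  assumes "m < k"
  shows "bij_betw (\<lambda>(g, T). T(m := f)) (SIGMA g:steps (s (Suc m)) f. walks k s (Suc m) g) (walks k s m f)"
proof (rule bij_betw_byWitness[where f' = "\<lambda>T. (T (Suc m), T(m := \<lambda>_. 0))"])
  show "\<forall>x\<in>(SIGMA g:steps (s (Suc m)) f. walks k s (Suc m) g).
      (\<lambda>T. (T (Suc m), T(m := \<lambda>_. 0))) ((\<lambda>(g, T). T(m := f)) x) = x"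
    by (auto simp: walks_def)
  show "\<forall>T\<in>walks k s m f. (\<lambda>(g, T). T(m := f)) (T (Suc m), T(m := \<lambda>_. 0)) = T"
    by (auto simp: walks_def)
  show "(\<lambda>(g, T). T(m := f)) ` (SIGMA g:steps (s (Suc m)) f. walks k s (Suc m) g) \<subseteq> walks k s m f"
  proof clarify
    fix g T assume g: "g \<in> steps (s (Suc m)) f" and T: "T \<in> walks k s (Suc m) g"
    then have "(T(m := f)) i \<in> parts_of (s i)" if "i \<in> {m<..k}" for i
      using that by (cases "i = Suc m") (auto simp: walks_def steps_def)
    moreover have "interlaces ((T(m := f)) i) ((T(m := f)) (Suc i)) \<or>
        interlaces ((T(m := f)) (Suc i)) ((T(m := f)) i)" if "i \<in> {m..<k}" for i
      using that g T by (cases "i = m") (auto simp: walks_def steps_def)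
    ultimately show "T(m := f) \<in> walks k s m f"
      using assms T by (auto simp: walks_def)
  qed
  show "(\<lambda>T. (T (Suc m), T(m := \<lambda>_. 0))) ` walks k s m f \<subseteq>
      (SIGMA g:steps (s (Suc m)) f. walks k s (Suc m) g)"
    using assms by (auto simp: walks_def steps_def less_Suc_eq Suc_le_eq)
qed

lemma finite_walks:
  assumes "m \<le> k"
  shows "finite (walks k s m f)"
  using assms
proof (induction m arbitrary: f rule: inc_induct)
  case (step m)
  then show ?case
    using bij_betw_finite[OF bij_betw_walks_Suc[of m k f s]] finite_steps by auto
qed (simp add: walks_end)

lemma card_walks_Suc:
  assumes "m < k"
  shows "card (walks k s m f) = (\<Sum>g\<in>steps (s (Suc m)) f. card (walks k s (Suc m) g))"
  using assms by (subst bij_betw_same_card[OF bij_betw_walks_Suc, symmetric])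
    (auto simp: finite_steps finite_walks)

text \<open>The columns \<open>m, \<dots>, k - 1\<close> of a strictly upper triangular matrix, \<open>a i j\<close> being the
  entry in row \<open>j\<close> and column \<open>i\<close>; \<open>v\<close> holds what the rows above \<open>m\<close> still have to receive.\<close>

definition fillings :: "nat \<Rightarrow> (nat \<Rightarrow> nat) \<Rightarrow> nat \<Rightarrow> (nat \<Rightarrow> nat) \<Rightarrow> (nat \<Rightarrow> nat \<Rightarrow> nat) set" where
  "fillings k s m v = {a. (\<forall>i j. \<not> (m \<le> i \<and> i < k \<and> j < i) \<longrightarrow> a i j = 0) \<and>
     (\<forall>i\<in>{m..<k}. (\<Sum>j<i. a i j) = s i - s (Suc i)) \<and>
     (\<forall>j<k. (\<Sum>i=m..<k. a i j) = (if j < m then v j else s (Suc j) - s j))}"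

lemma fillings_end:
  assumes "\<And>j. v j = 0"
  shows "fillings k s k v = {\<lambda>_ _. 0}"
  using assms by (auto simp: fillings_def fun_eq_iff)

text \<open>Column \<open>m\<close> is \<open>v - y\<close>, the part of each strip that is removed
  in this step; later columns must supply the remainder \<open>y\<close>, together with
  \<open>s (Suc m) - s m\<close> for the new row \<open>m\<close>. On an up step
  \<open>y = v\<close>, so the column is zero.\<close>

lemma bij_betw_fillings_Suc:
  assumes m: "m < k" and v: "\<And>j. j \<ge> m \<Longrightarrow> v j = 0" "(\<Sum>j<m. v j) = s m"
  shows "bij_betw (\<lambda>(y, b). b(m := \<lambda>j. v j - y j))
    (SIGMA y:subvectors m v (min (s m) (s (Suc m))). fillings k s (Suc m) (y(m := s (Suc m) - s m)))
    (fillings k s m v)" (is "bij_betw ?\<phi> ?A ?B")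
proof -
  let ?\<psi> = "\<lambda>a. (\<lambda>j. v j - a m j, a(m := \<lambda>_. 0::nat))"
  have split: "(\<Sum>i=m..<k. a i j) = a m j + (\<Sum>i=Suc m..<k. a i j)" for a :: "nat \<Rightarrow> nat \<Rightarrow> nat" and j
    using m by (rule sum.atLeast_Suc_lessThan)
  have upd: "(\<Sum>i=Suc m..<k. (a(m := x)) i j) = (\<Sum>i=Suc m..<k. a i j)"
    for a :: "nat \<Rightarrow> nat \<Rightarrow> nat" and x j
    by (intro sum.cong) auto
  have fwd: "?\<phi> (y, b) \<in> ?B \<and> ?\<psi> (?\<phi> (y, b)) = (y, b)" if "(y, b) \<in> ?A" for y b
  proof -
    from that have y: "\<And>j. j < m \<Longrightarrow> y j \<le> v j" "\<And>j. j \<ge> m \<Longrightarrow> y j = 0"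
        "(\<Sum>j<m. y j) = min (s m) (s (Suc m))"
      and b: "\<And>i j. \<not> (Suc m \<le> i \<and> i < k \<and> j < i) \<Longrightarrow> b i j = 0"
        "\<And>i. Suc m \<le> i \<Longrightarrow> i < k \<Longrightarrow> (\<Sum>j<i. b i j) = s i - s (Suc i)"
        "\<And>j. j < k \<Longrightarrow> (\<Sum>i=Suc m..<k. b i j) = (if j < Suc m then (y(m := s (Suc m) - s m)) j else s (Suc j) - s j)"
      by (auto simp: subvectors_def fillings_def)
    have le: "y j \<le> v j" for j using y v by (cases "j < m") auto
    have "(\<Sum>j<m. v j - y j) = s m - s (Suc m)"
      using le by (subst sum_subtractf_nat) (auto simp: v y)
    moreover have "(\<Sum>i=m..<k. (b(m := \<lambda>j. v j - y j)) i j) = (if j < m then v j else s (Suc j) - s j)"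
      if "j < k" for j
      unfolding split upd using b(3)[OF that] le[of j] v(1)[of j] by (auto simp: less_Suc_eq)
    ultimately have "?\<phi> (y, b) \<in> ?B"
      using b(1,2) v(1) m by (auto simp: fillings_def)
    moreover have "b m = (\<lambda>_. 0)" using b(1) by auto
    then have "?\<psi> (?\<phi> (y, b)) = (y, b)" using le by (auto simp: fun_eq_iff)
    ultimately show ?thesis by blast
  qed
  have bwd: "?\<psi> a \<in> ?A \<and> ?\<phi> (?\<psi> a) = a" if "a \<in> ?B" for a
  proof -
    from that have a: "\<And>i j. \<not> (m \<le> i \<and> i < k \<and> j < i) \<Longrightarrow> a i j = 0"
        "\<And>i. m \<le> i \<Longrightarrow> i < k \<Longrightarrow> (\<Sum>j<i. a i j) = s i - s (Suc i)"
        "\<And>j. j < k \<Longrightarrow> (\<Sum>i=m..<k. a i j) = (if j < m then v j else s (Suc j) - s j)"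
      by (auto simp: fillings_def)
    have le: "a m j \<le> v j" for j
    proof (cases "j < m")
      case True
      then show ?thesis using a(3)[of j] m split[of a j] by simp
    qed (simp add: a(1))
    \<comment> \<open>Truncation makes \<open>s m - (s m - s (Suc m))\<close> the minimum.\<close>
    have "(\<Sum>j<m. v j - a m j) = min (s m) (s (Suc m))"
      using le m by (subst sum_subtractf_nat) (auto simp: v a(2))
    then have y: "(\<lambda>j. v j - a m j) \<in> subvectors m v (min (s m) (s (Suc m)))"
      using v(1) by (auto simp: subvectors_def)
    have "(\<Sum>i=Suc m..<k. a i j) =
        (if j < Suc m then ((\<lambda>j. v j - a m j)(m := s (Suc m) - s m)) j else s (Suc j) - s j)"
      if "j < k" for j
      using a(3)[OF that] split[of a j] a(1)[of m j] by (auto simp: less_Suc_eq)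
    then have "a(m := \<lambda>_. 0) \<in> fillings k s (Suc m) ((\<lambda>j. v j - a m j)(m := s (Suc m) - s m))"
      unfolding fillings_def mem_Collect_eq upd using a(1,2) by auto
    then have "?\<psi> a \<in> ?A" using y by blast
    moreover have "?\<phi> (?\<psi> a) = a" using le by (auto simp: fun_eq_iff)
    ultimately show ?thesis by blast
  qed
  show ?thesis
  proof (rule bij_betw_byWitness[where f' = ?\<psi>])
    show "\<forall>x\<in>?A. ?\<psi> (?\<phi> x) = x" "?\<phi> ` ?A \<subseteq> ?B" using fwd by fast+
    show "\<forall>a\<in>?B. ?\<phi> (?\<psi> a) = a" "?\<psi> ` ?B \<subseteq> ?A" using bwd by fast+
  qed
qed

section \<open>Counting walks by fillings\<close>

lemma sum_lessThan_Suc_upd: "(\<Sum>j<Suc m. (y(m := c)) j) = (\<Sum>j<m. y j) + (c::nat)"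
  by simp

text \<open>The sum counts pairs of a chain with strip sizes \<open>v\<close> up to \<open>f\<close>
  and a walk from \<open>f\<close> to the end. Downward induction on \<open>m\<close> transfers one
  step at a time from the walk into the chain, which follows the recursion of the fillings. For
  \<open>m = 0\<close> only the walks remain.\<close>

lemma finite_card_fillings:
  assumes "m \<le> k" "s k = 0" "\<And>j. j \<ge> m \<Longrightarrow> v j = 0" "(\<Sum>j<m. v j) = s m"
  shows "finite (fillings k s m v) \<and>
    (\<Sum>f\<in>parts_of (s m). chain_count m v f * card (walks k s m f)) = card (fillings k s m v)"
  using assms(1,3,4)
proof (induction m arbitrary: v rule: inc_induct)
  case base
  then have "v j = 0" for j using \<open>s k = 0\<close> by (cases "j < k") auto
  then show ?case
    using \<open>s k = 0\<close> by (simp add: fillings_end walks_end parts_of_0 chain_count_zero)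
next
  case (step m)
  let ?Y = "subvectors m v (min (s m) (s (Suc m)))"
  let ?u = "\<lambda>y. y(m := s (Suc m) - s m)"
  \<comment> \<open>The new vector sums to \<open>min (s m) (s (Suc m)) + (s (Suc m) - s m)\<close>,
    which is \<open>s (Suc m)\<close> in either direction.\<close>
  have u: "j \<ge> Suc m \<Longrightarrow> ?u y j = 0" "(\<Sum>j<Suc m. ?u y j) = s (Suc m)" if "y \<in> ?Y" for y j
    using that unfolding sum_lessThan_Suc_upd by (auto simp: subvectors_def)
  note IH = step.IH[OF u]
  note bij = bij_betw_fillings_Suc[where s = s, OF \<open>m < k\<close> step.prems]
  have "finite (SIGMA y:?Y. fillings k s (Suc m) (?u y))"
    using IH finite_subvectors by blast
  then have fin: "finite (fillings k s m v)" using bij_betw_finite[OF bij] by simp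
  have "(\<Sum>f\<in>parts_of (s m). chain_count m v f * card (walks k s m f)) =
      (\<Sum>f\<in>parts_of (s m). \<Sum>g | g \<in> parts_of (s (Suc m)) \<and> (interlaces f g \<or> interlaces g f).
        chain_count m v f * card (walks k s (Suc m) g))"
    by (simp add: card_walks_Suc[OF \<open>m < k\<close>] sum_distrib_left steps_def)
  also have "\<dots> = (\<Sum>g\<in>parts_of (s (Suc m)). \<Sum>f | f \<in> parts_of (s m) \<and> (interlaces f g \<or> interlaces g f).
        chain_count m v f * card (walks k s (Suc m) g))"
    by (rule sum.swap_restrict) (simp_all add: finite_parts_of)
  also have "\<dots> = (\<Sum>g\<in>parts_of (s (Suc m)). \<Sum>y\<in>?Y.
        chain_count (Suc m) (?u y) g * card (walks k s (Suc m) g))"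
  proof (rule sum.cong[OF refl])
    fix g assume "g \<in> parts_of (s (Suc m))"
    from chain_count_step[where v = v and m = m, OF step.prems(1) this]
    show "(\<Sum>f | f \<in> parts_of (s m) \<and> (interlaces f g \<or> interlaces g f).
        chain_count m v f * card (walks k s (Suc m) g)) =
      (\<Sum>y\<in>?Y. chain_count (Suc m) (?u y) g * card (walks k s (Suc m) g))"
      unfolding step.prems(2) sum_distrib_right[symmetric] by (rule arg_cong)
  qed
  also have "\<dots> = (\<Sum>y\<in>?Y. \<Sum>g\<in>parts_of (s (Suc m)).
        chain_count (Suc m) (?u y) g * card (walks k s (Suc m) g))"
    by (rule sum.swap)
  also have "\<dots> = (\<Sum>y\<in>?Y. card (fillings k s (Suc m) (?u y)))"
    using IH by (intro sum.cong refl) blast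
  also have "\<dots> = card (SIGMA y:?Y. fillings k s (Suc m) (?u y))"
    by (rule card_SigmaI[symmetric]) (use IH finite_subvectors in blast)+
  also have "\<dots> = card (fillings k s m v)" by (rule bij_betw_same_card[OF bij])
  finally show ?case using fin by blast
qed

lemma card_walks_eq_card_fillings:
  assumes "s 0 = 0" "s k = 0"
  shows "card (walks k s 0 (\<lambda>_. 0)) = card (fillings k s 0 (\<lambda>_. 0))"
  using finite_card_fillings[of 0 k s "\<lambda>_. 0"] assms by (simp add: parts_of_0)

lemma finite_fillings:
  assumes "s 0 = 0" "s k = 0"
  shows "finite (fillings k s 0 (\<lambda>_. 0))"
  using finite_card_fillings[of 0 k s "\<lambda>_. 0"] assms by simp

section \<open>Column lengths of Young diagrams\<close>

lemma finite_downset_nat: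
  fixes D :: "nat set"
  assumes "finite D" "\<And>x y. x \<in> D \<Longrightarrow> y \<le> x \<Longrightarrow> y \<in> D"
  shows "D = {..<card D}"
proof -
  define N where "N = (LEAST n. n \<notin> D)"
  have "\<exists>n. n \<notin> D" using assms(1) ex_new_if_finite by blast
  then have "N \<notin> D" unfolding N_def by (rule LeastI_ex)
  then have "x < N" if "x \<in> D" for x
    using assms(2)[OF that, of N] by (meson leI)
  moreover have "x \<in> D" if "x < N" for x
    using not_less_Least[of x "\<lambda>n. n \<notin> D"] that by (simp add: N_def)
  ultimately have "D = {..<N}" by auto
  then show ?thesis by simp
qed

text \<open>The conjugate partition, padded with zeros.\<close>

definition column_length :: "nat list \<Rightarrow> nat \<Rightarrow> nat" where
  "column_length \<mu> c = card {r. (r, c) \<in> young_diagram \<mu>}"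

lemma young_diagram_partition:
  assumes "is_partition \<mu>"
  shows "young_diagram \<mu> = {(r, c). r < column_length \<mu> c}"
proof -
  have "{r. (r, c) \<in> young_diagram \<mu>} = {..<column_length \<mu> c}" for c
    unfolding column_length_def
  proof (rule finite_downset_nat)
    show "finite {r. (r, c) \<in> young_diagram \<mu>}"
      by (rule finite_subset[of _ "{..<length \<mu>}"]) (auto simp: young_diagram_def)
    fix r r' assume r: "r \<in> {r. (r, c) \<in> young_diagram \<mu>}" and "r' \<le> r"
    then have "\<mu> ! r \<le> \<mu> ! r'"
      using assms sorted_wrt_nth_less[of "(\<ge>)" \<mu> r' r]
      by (cases "r' = r") (auto simp: is_partition_def young_diagram_def)
    then show "r' \<in> {r. (r, c) \<in> young_diagram \<mu>}"
      using r \<open>r' \<le> r\<close> by (auto simp: young_diagram_def)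
  qed
  then show ?thesis by auto
qed

lemma column_length_in_parts_of:
  assumes "is_partition \<mu>"
  shows "column_length \<mu> \<in> parts_of (num_boxes \<mu>)"
proof (rule parts_ofI[where N = "sum_list \<mu>"])
  have fin: "finite {r. (r, c) \<in> young_diagram \<mu>}" for c
    by (rule finite_subset[of _ "{..<length \<mu>}"]) (auto simp: young_diagram_def)
  show anti: "antimono (column_length \<mu>)"
    unfolding antimono_iff_le_Suc column_length_def
    by (intro allI card_mono fin) (auto simp: young_diagram_def)
  have "\<mu> ! r \<le> sum_list \<mu>" if "r < length \<mu>" for r
    using that by (rule elem_le_sum_list)
  then show z: "column_length \<mu> (sum_list \<mu>) = 0"
    by (auto simp: column_length_def young_diagram_def dest: leD)
  have "column_length \<mu> c = 0" if "sum_list \<mu> \<le> c" for c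
    using antimonoD[OF anti that] z by simp
  then have "c < sum_list \<mu>" if "r < column_length \<mu> c" for r c
    using that by (metis leI not_less_zero)
  \<comment> \<open>The boxes are listed column by column, so that their number is the sum of the
    column lengths.\<close>
  then have "prod.swap ` young_diagram \<mu> = (SIGMA c:{..<sum_list \<mu>}. {..<column_length \<mu> c})"
    unfolding young_diagram_partition[OF assms] by (auto simp: image_iff)
  then have "card (prod.swap ` young_diagram \<mu>) = (\<Sum>c<sum_list \<mu>. column_length \<mu> c)"
    by simp
  then show "(\<Sum>c<sum_list \<mu>. column_length \<mu> c) = num_boxes \<mu>"
    by (simp add: card_image)
qed

lemma inj_on_column_length: "inj_on column_length {\<mu>. is_partition \<mu>}"
proof (rule inj_onI, clarify)
  fix \<mu> \<nu> assume *: "is_partition \<mu>" "is_partition \<nu>" "column_length \<mu> = column_length \<nu>"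
  then have Y: "young_diagram \<mu> = young_diagram \<nu>" by (simp add: young_diagram_partition)
  \<comment> \<open>All parts are positive, so every row has a box in the first column and the
    diagram determines the length of the list.\<close>
  have len: "{r. (r, 0) \<in> young_diagram \<mu>} = {..<length \<mu>}" if "is_partition \<mu>" for \<mu>
    using that by (auto simp: young_diagram_def is_partition_def in_set_conv_nth)
  have "length \<mu> = length \<nu>"
    using len[OF *(1)] len[OF *(2)] Y by simp
  moreover have "\<mu> ! r = \<nu> ! r" if "r < length \<mu>" for r
  proof -
    have "{c. (r, c) \<in> young_diagram \<mu>} = {..<\<mu> ! r}" "{c. (r, c) \<in> young_diagram \<nu>} = {..<\<nu> ! r}"
      using that \<open>length \<mu> = length \<nu>\<close> by (auto simp: young_diagram_def)
    then show ?thesis using Y by simp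
  qed
  ultimately show "\<mu> = \<nu>" by (rule nth_equalityI)
qed

lemma column_length_surj:
  assumes f: "f \<in> parts_of n"
  obtains \<mu> where "is_partition \<mu>" "column_length \<mu> = f"
proof
  \<comment> \<open>The conjugate of \<open>f\<close>: row \<open>r\<close> has a box in each column
    longer than \<open>r\<close>.\<close>
  let ?\<mu> = "map (\<lambda>r. card {c. r < f c}) [0..<f 0]"
  have fin: "finite {c. r < f c}" for r
  proof (rule finite_subset[of _ "{..<n}"])
    show "{c. r < f c} \<subseteq> {..<n}"
      using parts_ofD(2)[OF f] by (intro subsetI, clarsimp) (metis leI not_less_zero)
  qed simp
  have le: "f c \<le> f c'" if "c' \<le> c" for c c'
    using parts_ofD(1)[OF f] that by (rule antimonoD)
  have row: "{c. r < f c} = {..<card {c. r < f c}}" for r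
    by (rule finite_downset_nat[OF fin]) (use le less_le_trans in blast)
  have pos: "card {c. r < f c} > 0" if "r < f 0" for r
    using that fin by (subst card_gt_0_iff) auto
  have "card {c. r < f c} \<le> card {c. r' < f c}" if "r' \<le> r" for r r'
    using that fin by (intro card_mono) auto
  then show "is_partition ?\<mu>"
    using pos by (fastforce simp: is_partition_def sorted_wrt_iff_nth_less)
  have "(r, c) \<in> young_diagram ?\<mu> \<longleftrightarrow> r < f 0 \<and> c \<in> {c. r < f c}" for r c
    by (subst row) (auto simp: young_diagram_def)
  also have "\<dots> r c \<longleftrightarrow> r < f c" for r c
    using le[of 0 c] by auto
  finally have "(r, c) \<in> young_diagram ?\<mu> \<longleftrightarrow> r < f c" for r c .
  then show "column_length ?\<mu> = f" by (simp add: column_length_def fun_eq_iff)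
qed

text \<open>Containment compares column lengths. Given containment of the columns in order of
  length, two boxes of the skew diagram share a row only if some two adjacent columns do, and this
  is excluded by the second inequality of \<open>interlaces\<close>.\<close>

lemma vertical_strip_iff_interlaces:
  assumes "is_partition \<mu>" "is_partition \<nu>"
  shows "vertical_strip \<nu> \<mu> \<longleftrightarrow> interlaces (column_length \<mu>) (column_length \<nu>)"
proof -
  let ?f = "column_length \<mu>" and ?g = "column_length \<nu>"
  note f = column_length_in_parts_of[OF assms(1)] and g = column_length_in_parts_of[OF assms(2)]
  have sub: "young_diagram \<mu> \<subseteq> young_diagram \<nu> \<longleftrightarrow> (\<forall>c. ?f c \<le> ?g c)"
  proof
    assume sub: "young_diagram \<mu> \<subseteq> young_diagram \<nu>"
    have "(?g c, c) \<notin> young_diagram \<mu>" for c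
      using sub unfolding young_diagram_partition[OF assms(2)] by auto
    then show "\<forall>c. ?f c \<le> ?g c"
      unfolding young_diagram_partition[OF assms(1)] by (simp add: not_less)
  next
    assume "\<forall>c. ?f c \<le> ?g c"
    then show "young_diagram \<mu> \<subseteq> young_diagram \<nu>"
      unfolding young_diagram_partition[OF assms(1)] young_diagram_partition[OF assms(2)]
      by (auto intro: less_le_trans)
  qed
  define D where "D r = {c. ?f c \<le> r \<and> r < ?g c}" for r
  have D: "{c. (r, c) \<in> young_diagram \<nu> - young_diagram \<mu>} = D r" for r
    unfolding young_diagram_partition[OF assms(1)] young_diagram_partition[OF assms(2)] D_def
    by auto
  have finD: "finite (D r)" for r
  proof (rule finite_subset[of _ "{..<num_boxes \<nu>}"])
    show "D r \<subseteq> {..<num_boxes \<nu>}"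
      using parts_ofD(2)[OF g] unfolding D_def
      by (intro subsetI, clarsimp) (metis leI not_less_zero)
  qed simp
  have "(\<forall>r. card (D r) \<le> 1) \<longleftrightarrow> (\<forall>c. ?g (Suc c) \<le> ?f c)"
  proof
    assume *: "\<forall>r. card (D r) \<le> 1"
    show "\<forall>c. ?g (Suc c) \<le> ?f c"
    proof (rule allI, rule ccontr)
      fix c assume "\<not> ?g (Suc c) \<le> ?f c"
      \<comment> \<open>Row \<open>?f c\<close>, counted from 0, is the first one below column
        \<open>c\<close> of \<open>\<mu>\<close>; there both columns would contribute a box.\<close>
      then have "c \<in> D (?f c)" "Suc c \<in> D (?f c)"
        using antimonoD[OF parts_ofD(1)[OF f], of c "Suc c"] antimonoD[OF parts_ofD(1)[OF g], of c "Suc c"]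
        by (auto simp: D_def)
      moreover have "card (D (?f c)) \<le> Suc 0" using * by simp
      ultimately have "c = Suc c" unfolding card_le_Suc0_iff_eq[OF finD] by blast
      then show False by simp
    qed
  next
    assume *: "\<forall>c. ?g (Suc c) \<le> ?f c"
    have lt: False if "c < c'" "c \<in> D r" "c' \<in> D r" for c c' r
    proof -
      have "?g c' \<le> ?g (Suc c)" using that by (intro antimonoD[OF parts_ofD(1)[OF g]]) simp
      also have "\<dots> \<le> ?f c" using * by blast
      finally show False using that by (simp add: D_def)
    qed
    show "\<forall>r. card (D r) \<le> 1"
      unfolding One_nat_def card_le_Suc0_iff_eq[OF finD]
    proof (intro allI ballI)
      fix r c c' assume "c \<in> D r" "c' \<in> D r"
      then show "c = c'" using lt[of c c' r] lt[of c' c r] by (meson linorder_neqE_nat)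
    qed
  qed
  then show ?thesis
    unfolding vertical_strip_def D sub interlaces_def by blast
qed

lemma column_length_Nil: "column_length [] = (\<lambda>_. 0)"
  by (simp add: column_length_def young_diagram_def fun_eq_iff)

lemma is_partition_Nil: "is_partition []"
  by (simp add: is_partition_def)

lemma bij_betw_tableaux_walks:
  assumes s: "s 0 = 0" "s k = 0"
  shows "bij_betw (\<lambda>T i. if i \<le> k then column_length (T ! i) else (\<lambda>_. 0))
    {T. oscillating_tableau k T \<and> (\<forall>i\<le>k. num_boxes (T ! i) = s i)} (walks k s 0 (\<lambda>_. 0))"
    (is "bij_betw ?\<phi> ?A ?B")
proof -
  define inv_col where "inv_col = inv_into {\<mu>. is_partition \<mu>} column_length"
  have inv: "is_partition (inv_col f)" "column_length (inv_col f) = f" if "f \<in> parts_of n" for f n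
  proof -
    have f: "f \<in> column_length ` {\<mu>. is_partition \<mu>}"
      using column_length_surj[OF that] by blast
    show "is_partition (inv_col f)" "column_length (inv_col f) = f"
      unfolding inv_col_def using inv_into_into[OF f] f_inv_into_f[OF f] by simp_all
  qed
  have inv_l: "inv_col (column_length \<mu>) = \<mu>" if "is_partition \<mu>" for \<mu>
    unfolding inv_col_def using inj_on_column_length that by (simp add: inv_into_f_f)
  let ?\<psi> = "\<lambda>W. map (\<lambda>i. inv_col (W i)) [0..<Suc k]"
  show ?thesis
  proof (rule bij_betw_byWitness[where f' = ?\<psi>])
    have part: "is_partition (T ! i)" if "T \<in> ?A" "i \<le> k" for T i
      using that by (auto simp: oscillating_tableau_def)
    show "\<forall>T\<in>?A. ?\<psi> (?\<phi> T) = T"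
    proof
      fix T assume T: "T \<in> ?A"
      show "?\<psi> (?\<phi> T) = T"
        by (rule nth_equalityI)
          (use T in \<open>auto simp: oscillating_tableau_def inv_l part[OF T] less_Suc_eq_le simp del: upt_Suc\<close>)
    qed
    show "?\<phi> ` ?A \<subseteq> ?B"
    proof clarify
      fix T assume T: "oscillating_tableau k T" "\<forall>i\<le>k. num_boxes (T ! i) = s i"
      then have p: "is_partition (T ! i)" if "i \<le> k" for i
        using that part by blast
      show "?\<phi> T \<in> ?B"
        using T column_length_in_parts_of[OF p]
        by (auto simp: walks_def oscillating_tableau_def column_length_Nil p Suc_le_eq
            vertical_strip_iff_interlaces[symmetric])
    qed
    have W: "W i \<in> parts_of (s i)" if "W \<in> ?B" "i \<le> k" for W i
      using that s by (cases "i = 0") (auto simp: walks_def parts_of_0)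
    show "\<forall>W\<in>?B. ?\<phi> (?\<psi> W) = W"
      using inv(2)[OF W] by (auto simp: fun_eq_iff walks_def less_Suc_eq_le simp del: upt_Suc)
    show "?\<psi> ` ?B \<subseteq> ?A"
    proof clarify
      fix W assume "W \<in> ?B"
      note W = W[OF this]
      have nth: "?\<psi> W ! i = inv_col (W i)" if "i \<le> k" for i
        using that by (simp del: upt_Suc add: less_Suc_eq_le)
      have nil: "inv_col (W i) = []" if "i \<le> k" "s i = 0" for i
        using W[OF that(1)] that(2) inv_l[OF is_partition_Nil] by (simp add: parts_of_0 column_length_Nil)
      have boxes: "num_boxes (inv_col (W i)) = s i" if "i \<le> k" for i
        using column_length_in_parts_of[OF inv(1)[OF W[OF that]]] inv(2)[OF W[OF that]] W[OF that]
          parts_of_unique by metis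
      have "vertical_strip (inv_col (W (Suc i))) (inv_col (W i)) \<or>
          vertical_strip (inv_col (W i)) (inv_col (W (Suc i)))" if "i < k" for i
      proof -
        note i = W[of i] W[of "Suc i"]
        show ?thesis
          using that \<open>W \<in> ?B\<close> inv[OF i(1)] inv[OF i(2)]
          by (simp add: walks_def vertical_strip_iff_interlaces)
      qed
      then show "oscillating_tableau k (?\<psi> W) \<and> (\<forall>i\<le>k. num_boxes (?\<psi> W ! i) = s i)"
        using boxes nil s inv(1)[OF W]
        by (auto simp: oscillating_tableau_def nth less_Suc_eq_le simp del: upt_Suc)
    qed
  qed
qed

section \<open>Matrices and fillings\<close>

text \<open>The diagonal entry is a summand of both contents, and one of these vanishes.\<close>

lemma fpf_diag_zero:
  assumes "nat_fpf_involution k A" "i < k"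
  shows "A $$ (i, i) = 0"
proof -
  have "A $$ (i, i) \<le> row_content A i"
    using assms unfolding row_content_def nat_fpf_involution_def by (intro member_le_sum) auto
  moreover have "A $$ (i, i) \<le> col_content A i"
    unfolding col_content_def by (rule member_le_sum) auto
  ultimately show ?thesis using assms unfolding nat_fpf_involution_def by fastforce
qed

lemma row_content_strict:
  assumes A: "A \<in> carrier_mat k k" and "A $$ (i, i) = 0"
  shows "row_content A i = (\<Sum>j=0..<k. if i < j then A $$ (i, j) else 0)"
proof -
  have "row_content A i = (\<Sum>j=i..<k. if i < j then A $$ (i, j) else 0)"
    unfolding row_content_def using assms by (intro sum.cong) (auto simp: le_less)
  also have "\<dots> = (\<Sum>j=0..<k. if i < j then A $$ (i, j) else 0)"
    by (rule sum.mono_neutral_left) auto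
  finally show ?thesis .
qed

lemma col_content_strict:
  assumes "A $$ (i, i) = 0"
  shows "col_content A i = (\<Sum>j<i. A $$ (j, i))"
  using assms by (simp add: col_content_def flip: lessThan_Suc_atMost)

text \<open>A symmetric matrix with zero diagonal is determined by its strictly upper triangular
  part, whose row and column sums are the contents.\<close>

lemma bij_betw_matrices_fillings:
  "bij_betw (\<lambda>A i j. if j < i \<and> i < k then A $$ (j, i) else 0)
    {A. nat_fpf_involution k A \<and>
       (\<forall>i<k. row_content A i = s (Suc i) - s i \<and> col_content A i = s i - s (Suc i))}
    (fillings k s 0 (\<lambda>_. 0))"
    (is "bij_betw ?\<phi> ?A ?B")
proof (rule bij_betw_byWitness)
  let ?\<psi> = "\<lambda>a. mat k k (\<lambda>(i, j). if i < j then a j i else a i j)"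
  show "\<forall>A\<in>?A. ?\<psi> (?\<phi> A) = A"
  proof clarify
    fix A assume A: "nat_fpf_involution k A"
    then have dim: "A \<in> carrier_mat k k" and sym: "transpose_mat A = A"
      by (auto simp: nat_fpf_involution_def)
    have "A $$ (i, j) = A $$ (j, i)" if "i < k" "j < k" for i j
      using that dim arg_cong[OF sym, of "\<lambda>A. A $$ (i, j)"] by simp
    then show "?\<psi> (?\<phi> A) = A"
      using dim fpf_diag_zero[OF A] by (intro eq_matI) (auto simp: not_less le_less)
  qed
  show "?\<phi> ` ?A \<subseteq> ?B"
  proof clarify
    fix A assume A: "nat_fpf_involution k A"
      "\<forall>i<k. row_content A i = s (Suc i) - s i \<and> col_content A i = s i - s (Suc i)"
    then have dim: "A \<in> carrier_mat k k" by (simp add: nat_fpf_involution_def)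
    have "(\<Sum>i=0..<k. ?\<phi> A i j) = s (Suc j) - s j" if "j < k" for j
    proof -
      have "(\<Sum>i=0..<k. ?\<phi> A i j) = row_content A j"
        unfolding row_content_strict[OF dim fpf_diag_zero[OF A(1) that]]
        by (rule sum.cong) auto
      then show ?thesis using A(2) that by simp
    qed
    moreover have "(\<Sum>j<i. ?\<phi> A i j) = s i - s (Suc i)" if "i < k" for i
    proof -
      have "(\<Sum>j<i. ?\<phi> A i j) = col_content A i"
        unfolding col_content_strict[OF fpf_diag_zero[OF A(1) that]]
        using that by (intro sum.cong) auto
      then show ?thesis using A(2) that by simp
    qed
    ultimately show "?\<phi> A \<in> ?B" by (auto simp: fillings_def)
  qed
  show "\<forall>a\<in>?B. ?\<phi> (?\<psi> a) = a"
    by (auto simp: fillings_def fun_eq_iff)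
  show "?\<psi> ` ?B \<subseteq> ?A"
  proof clarify
    fix a assume "a \<in> ?B"
    then have a: "\<And>i j. \<not> (i < k \<and> j < i) \<Longrightarrow> a i j = 0"
        "\<And>i. i < k \<Longrightarrow> (\<Sum>j<i. a i j) = s i - s (Suc i)"
        "\<And>j. j < k \<Longrightarrow> (\<Sum>i=0..<k. a i j) = s (Suc j) - s j"
      by (auto simp: fillings_def)
    have dim: "?\<psi> a \<in> carrier_mat k k" by simp
    have diag: "?\<psi> a $$ (i, i) = 0" if "i < k" for i using that a(1) by simp
    have row: "row_content (?\<psi> a) i = s (Suc i) - s i" if "i < k" for i
      unfolding row_content_strict[OF dim diag[OF that]] a(3)[OF that, symmetric]
      using that a(1) by (intro sum.cong) auto
    have col: "col_content (?\<psi> a) i = s i - s (Suc i)" if "i < k" for i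
      unfolding col_content_strict[of "?\<psi> a" i, OF diag[OF that]] a(2)[OF that, symmetric]
      using that by (intro sum.cong) auto
    have "transpose_mat (?\<psi> a) = ?\<psi> a"
      by (rule eq_matI) auto
    \<comment> \<open>One of the two truncated differences is always zero, so one of the contents
      vanishes.\<close>
    then show "nat_fpf_involution k (?\<psi> a) \<and>
        (\<forall>i<k. row_content (?\<psi> a) i = s (Suc i) - s i \<and> col_content (?\<psi> a) i = s i - s (Suc i))"
      using dim row col by (auto simp: nat_fpf_involution_def)
  qed
qed

text \<open>The partition sizes forced on the tableau of \<open>A\<close> by the content conditions. The subtraction
  does not truncate: an entry in one of the first \<open>i\<close> columns lies in one of the first \<open>i\<close> rows.\<close>

definition size_sequence :: "nat \<Rightarrow> nat mat \<Rightarrow> nat \<Rightarrow> nat" where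
  "size_sequence k A i =
    (if i \<le> k then (\<Sum>j<i. row_content A j) - (\<Sum>j<i. col_content A j) else 0)"

text \<open>Double counting of the entries on or above the diagonal. Equality at \<open>k\<close>
  makes the size sequence return to 0.\<close>

lemma sum_col_content_le_sum_row_content:
  assumes "A \<in> carrier_mat k k"
  shows "i \<le> k \<Longrightarrow> (\<Sum>j<i. col_content A j) \<le> (\<Sum>j<i. row_content A j)"
    and "(\<Sum>j<k. col_content A j) = (\<Sum>j<k. row_content A j)"
proof -
  have swap: "(\<Sum>j<i. col_content A j) = (\<Sum>l<i. \<Sum>j=l..<i. A $$ (l, j))" for i
  proof -
    have "(\<Sum>j<i. col_content A j) = (\<Sum>j\<in>{..<i}. \<Sum>l | l \<in> {..<i} \<and> l \<le> j. A $$ (l, j))"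
      unfolding col_content_def by (intro sum.cong) auto
    also have "\<dots> = (\<Sum>l\<in>{..<i}. \<Sum>j | j \<in> {..<i} \<and> l \<le> j. A $$ (l, j))"
      by (rule sum.swap_restrict) auto
    also have "\<dots> = (\<Sum>l<i. \<Sum>j=l..<i. A $$ (l, j))"
      by (intro sum.cong) auto
    finally show ?thesis .
  qed
  show "(\<Sum>j<i. col_content A j) \<le> (\<Sum>j<i. row_content A j)" if "i \<le> k"
    using that unfolding swap row_content_def using assms by (intro sum_mono sum_mono2) auto
  show "(\<Sum>j<k. col_content A j) = (\<Sum>j<k. row_content A j)"
    unfolding swap row_content_def using assms by simp
qed

text \<open>The signed change of size is the row content minus the column content; as one of them is
  zero, truncated differences recover both.\<close>

lemma size_sequence_contents:
  assumes A: "nat_fpf_involution k A" and i: "i < k"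
  shows "row_content A i = size_sequence k A (Suc i) - size_sequence k A i"
    and "col_content A i = size_sequence k A i - size_sequence k A (Suc i)"
proof -
  have dim: "A \<in> carrier_mat k k" and "row_content A i = 0 \<or> col_content A i = 0"
    using assms by (auto simp: nat_fpf_involution_def)
  with i sum_col_content_le_sum_row_content(1)[OF dim, of i]
    sum_col_content_le_sum_row_content(1)[OF dim, of "Suc i"]
  show "row_content A i = size_sequence k A (Suc i) - size_sequence k A i"
    and "col_content A i = size_sequence k A i - size_sequence k A (Suc i)"
    by (auto simp: size_sequence_def)
qed

lemma size_sequence_unique:
  assumes "s 0 = 0" "\<And>i. k < i \<Longrightarrow> s i = 0"
    and s: "\<And>i. i < k \<Longrightarrow> row_content A i = s (Suc i) - s i"
       "\<And>i. i < k \<Longrightarrow> col_content A i = s i - s (Suc i)"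
  shows "size_sequence k A = s"
proof -
  have "(\<Sum>j<i. row_content A j) = (\<Sum>j<i. col_content A j) + s i" if "i \<le> k" for i
    using that
  proof (induction i)
    case (Suc i)
    then show ?case using s[of i] by simp
  qed (simp add: assms)
  then show ?thesis using assms(2) by (auto simp: size_sequence_def fun_eq_iff)
qed

text \<open>One bijection is chosen for each value of the statistic; the fibres partition both sets,
  so the choices glue together.\<close>

lemma bij_betw_fibres:
  assumes "\<And>s. \<exists>h. bij_betw h {x \<in> X. p x = s} {y \<in> Y. q y = s}"
  obtains \<Phi> where "bij_betw \<Phi> X Y" "\<And>x. x \<in> X \<Longrightarrow> q (\<Phi> x) = p x"
proof -
  from assms obtain h where h: "\<And>s. bij_betw (h s) {x \<in> X. p x = s} {y \<in> Y. q y = s}" by metis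
  let ?\<Phi> = "\<lambda>x. h (p x) x"
  have mem: "?\<Phi> x \<in> Y" "q (?\<Phi> x) = p x" if "x \<in> X" for x
    using bij_betw_apply[OF h, of x "p x"] that by auto
  have "inj_on ?\<Phi> X"
  proof (rule inj_onI)
    fix x x' assume *: "x \<in> X" "x' \<in> X" "?\<Phi> x = ?\<Phi> x'"
    then have "p x = p x'" using mem(2) by metis
    then show "x = x'"
      using * bij_betw_imp_inj_on[OF h, of "p x"] by (auto dest: inj_onD)
  qed
  moreover have "y \<in> ?\<Phi> ` X" if "y \<in> Y" for y
  proof -
    have "y \<in> h (q y) ` {x \<in> X. p x = q y}"
      using that bij_betw_imp_surj_on[OF h, of "q y"] by blast
    then show ?thesis by force
  qed
  ultimately have "bij_betw ?\<Phi> X Y" using mem(1) by (auto simp: bij_betw_def)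
  then show ?thesis using mem(2) that by blast
qed

theorem theorem6p10:
  fixes k :: nat
  assumes "k \<ge> 1"
  shows "\<exists>\<Phi> :: nat list list \<Rightarrow> nat mat.
    bij_betw \<Phi> {T. oscillating_tableau k T} {A. nat_fpf_involution k A} \<and>
    (\<forall>T. oscillating_tableau k T \<longrightarrow> (\<forall>i<k.
       int (row_content (\<Phi> T) i) = max (int (num_boxes (T ! Suc i)) - int (num_boxes (T ! i))) 0 \<and>
       int (col_content (\<Phi> T) i) = max (int (num_boxes (T ! i)) - int (num_boxes (T ! Suc i))) 0))"
proof -
  \<comment> \<open>The value 0 beyond \<open>k\<close> matches \<open>size_sequence\<close>, so
    that the two statistics can be compared as functions.\<close>
  let ?sizes = "\<lambda>T i. if i \<le> k then num_boxes (T ! i) else 0"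
  let ?X = "{T. oscillating_tableau k T}" and ?Y = "{A. nat_fpf_involution k A}"
  \<comment> \<open>The possible size sequences; for any other \<open>s\<close> both fibres are
    empty.\<close>
  define U where "U = {s :: nat \<Rightarrow> nat. s 0 = 0 \<and> s k = 0 \<and> (\<forall>i>k. s i = 0)}"
  have "\<exists>h. bij_betw h {T \<in> ?X. ?sizes T = s} {A \<in> ?Y. size_sequence k A = s}" for s
  proof (cases "s \<in> U")
    case True
    then have s: "s 0 = 0" "s k = 0" "\<And>i. k < i \<Longrightarrow> s i = 0" by (auto simp: U_def)
    have X: "{T \<in> ?X. ?sizes T = s} =
        {T. oscillating_tableau k T \<and> (\<forall>i\<le>k. num_boxes (T ! i) = s i)}"
      using s(3) by (auto simp: fun_eq_iff)
    have Y: "{A \<in> ?Y. size_sequence k A = s} = {A. nat_fpf_involution k A \<and>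
        (\<forall>i<k. row_content A i = s (Suc i) - s i \<and> col_content A i = s i - s (Suc i))}"
      using size_sequence_contents size_sequence_unique[of s k, OF s(1,3)] by blast
    note XW = bij_betw_tableaux_walks[of s k, OF s(1,2)]
    note YF = bij_betw_matrices_fillings[of k s]
    have "finite (walks k s 0 (\<lambda>_. 0))" "finite (fillings k s 0 (\<lambda>_. 0))"
      using finite_walks finite_fillings[OF s(1,2)] by auto
    \<comment> \<open>Only the cardinalities are known to agree, so \<open>g\<close> is an arbitrary
      bijection.\<close>
    then obtain g where g: "bij_betw g (walks k s 0 (\<lambda>_. 0)) (fillings k s 0 (\<lambda>_. 0))"
      using finite_same_card_bij card_walks_eq_card_fillings[OF s(1,2)] by blast
    show ?thesis
      unfolding X Y using bij_betw_trans[OF bij_betw_trans[OF XW g] bij_betw_inv_into[OF YF]] by blast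
  next
    case False
    have "?sizes T \<in> U" if "T \<in> ?X" for T
      using that by (auto simp: U_def oscillating_tableau_def young_diagram_def)
    then have "{T \<in> ?X. ?sizes T = s} = {}" using False by blast
    moreover have "size_sequence k A \<in> U" if "A \<in> ?Y" for A
      using that sum_col_content_le_sum_row_content(2)[of A k]
      by (auto simp: U_def size_sequence_def nat_fpf_involution_def)
    then have "{A \<in> ?Y. size_sequence k A = s} = {}" using False by blast
    ultimately show ?thesis by (simp only: bij_betw_def) simp
  qed
  then obtain \<Phi> where \<Phi>: "bij_betw \<Phi> ?X ?Y" "\<And>T. T \<in> ?X \<Longrightarrow> size_sequence k (\<Phi> T) = ?sizes T"
    by (rule bij_betw_fibres) blast
  have "int (row_content (\<Phi> T) i) = max (int (num_boxes (T ! Suc i)) - int (num_boxes (T ! i))) 0 \<and>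
      int (col_content (\<Phi> T) i) = max (int (num_boxes (T ! i)) - int (num_boxes (T ! Suc i))) 0"
    if T: "oscillating_tableau k T" and i: "i < k" for T i
  proof -
    have "nat_fpf_involution k (\<Phi> T)" using bij_betw_apply[OF \<Phi>(1)] T by blast
    from size_sequence_contents[OF this i] show ?thesis
      using \<Phi>(2)[of T] T i by (simp add: max_def of_nat_diff)
  qed
  then show ?thesis using \<Phi>(1) by blast
qed

end
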